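(* Let $r\ge 3$ be an integer such that $r-1$ is a prime power, let $m\ge 1$ be an integer, and let $n=(r-1)^2m+r$. Then there exists a $\{C_{1r},C^*\}$-free linear $r$-graph on $n$ vertices with $r(r-1)m$ edges; consequently $$ex_r^{lin}(n,\{C_{1r},C^*\})\ \ge\ r(r-1)\left\lfloor\frac{n-r}{(r-1)^2}\right\rfloor .$$
   Context: An $r$-graph $H=(V,E)$ consists of a (finite, nonempty) vertex set $V=V(H)$ and a collection $E=E(H)$ of $r$-element subsets of $V$, called edges. It is linear if any two distinct edges intersect in at most one vertex. For linear $r$-graphs $F_1,F_2$, an $r$-graph $H$ is $\{F_1,F_2\}$-free if it contains no copy of $F_1$ and no copy of $F_2$ as a (not necessarily induced) subhypergraph. The linear Turán number $ex_r^{lin}(n,\{F_1,F_2\})$ is the maximum number of edges in any $\{F_1,F_2\}$-free linear $r$-graph on $n$ vertices. The $r$-crown $C_{1r}$ is the linear $r$-graph on $r^2$ vertices with $r+1$ edges obtained from $r$ pairwise disjoint edges by adding one edge that intersects each of them in exactly one vertex. $C^*$ is the linear $r$-graph on $r^2-r+3$ vertices with $r+1$ edges $e_1,\dots,e_r,e$ such that: the $r-2$ edges $e_1,\dots,e_{r-2}$ all contain a common vertex $v$ and are otherwise pairwise disjoint (for $r=3$ there is just one such edge $e_1$, with $v$ a vertex of it); the edges $e_{r-1}$ and $e_r$ are disjoint from each other and from each of $e_1,\dots,e_{r-2}$; and the edge $e$ does not contain $v$ and intersects each of $e_1,\dots,e_r$ in exactly one vertex. *)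

theory Defs
  imports "HOL-Number_Theory.Prime_Powers" Complex_Main
begin

text \<open>A hypergraph is a pair of a vertex set and an edge set.\<close>

type_synonym 'a hypergraph = "'a set \<times> 'a set set"

abbreviation verts :: "'a hypergraph \<Rightarrow> 'a set" where "verts H \<equiv> fst H"
abbreviation edges :: "'a hypergraph \<Rightarrow> 'a set set" where "edges H \<equiv> snd H"

definition r_graph :: "nat \<Rightarrow> 'a hypergraph \<Rightarrow> bool" where
  "r_graph r H \<longleftrightarrow> finite (verts H) \<and> verts H \<noteq> {} \<and>
     (\<forall>e\<in>edges H. e \<subseteq> verts H \<and> card e = r)"

definition linear_hg :: "'a hypergraph \<Rightarrow> bool" where
  "linear_hg H \<longleftrightarrow> (\<forall>e\<in>edges H. \<forall>f\<in>edges H. e \<noteq> f \<longrightarrow> card (e \<inter> f) \<le> 1)"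

definition contains_copy :: "'a hypergraph \<Rightarrow> 'b hypergraph \<Rightarrow> bool" where
  "contains_copy H F \<longleftrightarrow>
     (\<exists>\<phi>. inj_on \<phi> (verts F) \<and> \<phi> ` verts F \<subseteq> verts H \<and> (\<forall>e\<in>edges F. \<phi> ` e \<in> edges H))"

definition free_of :: "'b hypergraph set \<Rightarrow> 'a hypergraph \<Rightarrow> bool" where
  "free_of \<F> H \<longleftrightarrow> (\<forall>F\<in>\<F>. \<not> contains_copy H F)"

text \<open>
  Every hypergraph on \<open>n\<close> vertices is isomorphic to one whose vertices are natural
  numbers, so it suffices to let \<open>H\<close> range over hypergraphs on subsets of \<open>nat\<close>.
  The maximum is over a nonempty set as soon as every member of \<open>\<F>\<close> has an edge
  and \<open>n > 0\<close>.
\<close>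

definition ex_lin :: "nat \<Rightarrow> nat \<Rightarrow> 'b hypergraph set \<Rightarrow> nat" where
  "ex_lin r n \<F> = Max {card (edges H) | H :: nat hypergraph.
     r_graph r H \<and> linear_hg H \<and> card (verts H) = n \<and> free_of \<F> H}"

text \<open>
  The vertices of the crown form an \<open>r \<times> r\<close> grid: the disjoint edges are the rows and
  the additional edge is column \<open>0\<close>.
\<close>

definition crown_row :: "nat \<Rightarrow> nat \<Rightarrow> (nat \<times> nat) set" where
  "crown_row r i = {i} \<times> {..<r}"

definition column0 :: "nat \<Rightarrow> (nat \<times> nat) set" where
  "column0 r = {..<r} \<times> {0}"

definition crown :: "nat \<Rightarrow> (nat \<times> nat) hypergraph" where
  "crown r = ({..<r} \<times> {..<r}, insert (column0 r) (crown_row r ` {..<r}))"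

text \<open>
  \<open>C\<^sup>*\<close> arises from the same grid by identifying the last vertices of the rows
  \<open>0, \<dots>, r - 3\<close> to the single vertex \<open>v = (0, r - 1)\<close>.  The rows \<open>r - 2\<close> and
  \<open>r - 1\<close> are left alone, and the edge \<open>e\<close> is again column \<open>0\<close>.
\<close>

definition cstar_row :: "nat \<Rightarrow> nat \<Rightarrow> (nat \<times> nat) set" where
  "cstar_row r i = insert (if i < r - 2 then 0 else i, r - 1) ({i} \<times> {..<r - 1})"

definition cstar :: "nat \<Rightarrow> (nat \<times> nat) hypergraph" where
  "cstar r = (\<Union>i<r. cstar_row r i, insert (column0 r) (cstar_row r ` {..<r}))"


text \<open>The two configurations have the defining properties.\<close>

lemma card_column0: "card (column0 r) = r"
  by (simp add: column0_def card_cartesian_product)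

lemma card_crown_row: "card (crown_row r i) = r"
  by (simp add: crown_row_def card_cartesian_product)

lemma card_cstar_row: "r > 0 \<Longrightarrow> card (cstar_row r i) = r"
  unfolding cstar_row_def by (subst card_insert_disjoint) (auto simp: card_cartesian_product)

lemma crown_row_disjoint: "i \<noteq> j \<Longrightarrow> crown_row r i \<inter> crown_row r j = {}"
  by (auto simp: crown_row_def)

lemma crown_row_Int_column0: "i < r \<Longrightarrow> crown_row r i \<inter> column0 r = {(i, 0)}"
  by (auto simp: crown_row_def column0_def)

lemma cstar_row_Int_star:
  "i < r - 2 \<Longrightarrow> j < r - 2 \<Longrightarrow> i \<noteq> j \<Longrightarrow> cstar_row r i \<inter> cstar_row r j = {(0, r - 1)}"
  by (auto simp: cstar_row_def)

lemma cstar_row_disjoint: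
  "r \<ge> 3 \<Longrightarrow> i < r \<Longrightarrow> j < r \<Longrightarrow> i \<noteq> j \<Longrightarrow> j \<ge> r - 2 \<Longrightarrow> cstar_row r i \<inter> cstar_row r j = {}"
  by (auto simp: cstar_row_def split: if_splits)

lemma cstar_row_Int_column0: "r \<ge> 3 \<Longrightarrow> i < r \<Longrightarrow> cstar_row r i \<inter> column0 r = {(i, 0)}"
  by (auto simp: cstar_row_def column0_def)

lemma cstar_centre:
  assumes "r \<ge> 3"
  shows "(0, r - 1) \<notin> column0 r" "i < r - 2 \<Longrightarrow> (0, r - 1) \<in> cstar_row r i"
  using assms by (auto simp: cstar_row_def column0_def)

lemma crown_r_graph: "r > 0 \<Longrightarrow> r_graph r (crown r)"
  by (auto simp: r_graph_def crown_def card_column0 card_crown_row)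
     (auto simp: crown_row_def column0_def)

lemma crown_linear: "linear_hg (crown r)"
proof -
  have "card (crown_row r i \<inter> crown_row r j) \<le> 1"
    if "crown_row r i \<noteq> crown_row r j" for i j
    using crown_row_disjoint[of i j r] that by (cases "i = j") auto
  then show ?thesis
    by (auto simp: linear_hg_def crown_def crown_row_Int_column0 Int_commute[of "column0 r"])
qed

lemma card_verts_crown: "card (verts (crown r)) = r\<^sup>2"
  by (simp add: crown_def card_cartesian_product power2_eq_square)

lemma card_edges_crown:
  assumes "r \<ge> 2"
  shows "card (edges (crown r)) = r + 1"
proof -
  have "inj_on (crown_row r) {..<r}"
    using assms by (auto simp: inj_on_def crown_row_def set_eq_iff)
  moreover have "column0 r \<notin> crown_row r ` {..<r}"
  proof
    assume "column0 r \<in> crown_row r ` {..<r}"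
    then obtain i where "i < r" "column0 r = crown_row r i" by auto
    with crown_row_Int_column0[of i r] have "card (column0 r) = 1" by simp
    with assms show False by (simp add: card_column0)
  qed
  ultimately show ?thesis by (simp add: crown_def card_image)
qed

lemma cstar_r_graph:
  assumes "r \<ge> 3"
  shows "r_graph r (cstar r)"
proof -
  have "column0 r \<subseteq> (\<Union>i<r. cstar_row r i)"
    using cstar_row_Int_column0[OF assms] by (auto simp: column0_def)
  moreover have "cstar_row r 0 \<noteq> {}" "0 < r"
    using assms by (auto simp: cstar_row_def)
  ultimately show ?thesis
    by (auto simp: r_graph_def cstar_def card_column0 card_cstar_row)
       (auto simp: cstar_row_def)
qed

lemma cstar_linear:
  assumes "r \<ge> 3"
  shows "linear_hg (cstar r)"
proof -
  have rows: "card (cstar_row r i \<inter> cstar_row r j) \<le> 1" if "i < r" "j < r" "i \<noteq> j" for i j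
  proof (cases "i < r - 2 \<and> j < r - 2")
    case True
    then show ?thesis using that cstar_row_Int_star[of i r j] by simp
  next
    case False
    then show ?thesis
      using that assms cstar_row_disjoint[of r i j] cstar_row_disjoint[of r j i]
      by (auto simp: Int_commute)
  qed
  then show ?thesis
    using assms by (auto simp: linear_hg_def cstar_def cstar_row_Int_column0
        Int_commute[of "column0 r"])
qed

lemma card_edges_cstar:
  assumes "r \<ge> 3"
  shows "card (edges (cstar r)) = r + 1"
proof -
  have "inj_on (cstar_row r) {..<r}"
  proof (rule inj_onI)
    fix i j assume "i \<in> {..<r}" "j \<in> {..<r}" "cstar_row r i = cstar_row r j"
    then have "{(i, 0)} = {(j, 0::nat)}"
      using cstar_row_Int_column0[OF assms, of i] cstar_row_Int_column0[OF assms, of j]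
      by (metis lessThan_iff)
    then show "i = j" by simp
  qed
  moreover have "column0 r \<notin> cstar_row r ` {..<r}"
  proof
    assume "column0 r \<in> cstar_row r ` {..<r}"
    then obtain i where "i < r" "column0 r = cstar_row r i" by auto
    with cstar_row_Int_column0[OF assms, of i] have "card (column0 r) = 1" by simp
    with assms show False by (simp add: card_column0)
  qed
  ultimately show ?thesis by (simp add: cstar_def card_image)
qed

lemma card_verts_cstar:
  assumes "r \<ge> 3"
  shows "card (verts (cstar r)) = r\<^sup>2 - r + 3"
proof -
  have "verts (cstar r) = ({..<r} \<times> {..<r - 1}) \<union> ({0, r - 2, r - 1} \<times> {r - 1})"
    (is "?V = ?W")
  proof
    show "?V \<subseteq> ?W"
      using assms by (auto simp: cstar_def cstar_row_def split: if_splits)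
    have "(i, j) \<in> ?V" if "i < r" "(i, j) \<in> cstar_row r i" for i j
      using that by (auto simp: cstar_def)
    then show "?W \<subseteq> ?V"
      using assms by (auto simp: cstar_row_def)
  qed
  moreover have "card (({..<r} \<times> {..<r - 1}) \<union> ({0, r - 2, r - 1} \<times> {r - 1})) = r * (r - 1) + 3"
    using assms by (subst card_Un_disjoint) (auto simp: card_cartesian_product)
  ultimately show ?thesis
    by (simp add: power2_eq_square right_diff_distrib')
qed

text \<open>The maximum defining \<open>ex_lin\<close> is taken over a finite set.\<close>

lemma finite_ex_lin_set:
  "finite {card (edges H) | H :: nat hypergraph.
     r_graph r H \<and> linear_hg H \<and> card (verts H) = n \<and> free_of \<F> H}"
proof -
  have "card (edges H) \<le> 2 ^ card (verts H)" if "r_graph r H" for H :: "nat hypergraph"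
  proof -
    have "edges H \<subseteq> Pow (verts H)" "finite (verts H)"
      using that by (auto simp: r_graph_def)
    then show ?thesis by (metis card_Pow card_mono finite_Pow_iff)
  qed
  then show ?thesis by (intro finite_subset[OF _ finite_atMost[of "2 ^ n"]]) auto
qed

end

(*
  Take m copies of the affine plane of order q = r - 1 and complete the lines of each copy by
  points at infinity that all copies share: two edges of the same copy always meet, so disjoint
  edges lie in different copies and have different points at infinity.  An edge meets an edge of
  another copy only in its unique point at infinity, so it cannot meet three pairwise disjoint
  edges.  Both the crown and C* contain an edge that does.

  The coordinatising field of order q = p^k consists of the fixed points of x -> x^q in the
  algebraic closure of Z/p; there are q of them because X^q - X = (X - a)^q - (X - a) has no
  double root a.
*)
theory Submission
  imports "HOL-Algebra.Algebraic_Closure" "HOL-Number_Theory.Residues"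
    "HOL-Library.Countable" Defs
begin

section \<open>Finite fields of prime power order\<close>

lemma (in cring) binomial:
  assumes x: "x \<in> carrier R" and y: "y \<in> carrier R"
  shows "(x \<oplus> y) [^] (n::nat) = (\<Oplus>i\<in>{..n}. [(n choose i)] \<cdot> (x [^] i \<otimes> y [^] (n - i)))"
proof (induction n)
  case 0
  show ?case using assms by simp
next
  case (Suc n)
  let ?B = "\<lambda>i. [(n choose i)] \<cdot> (x [^] i \<otimes> y [^] (n - i))"
  let ?C = "\<lambda>i. [(n choose i)] \<cdot> (x [^] Suc i \<otimes> y [^] (n - i))"
  let ?D = "\<lambda>i. [(n choose i)] \<cdot> (x [^] i \<otimes> y [^] (Suc n - i))"
  let ?E = "\<lambda>i. [(n choose Suc i)] \<cdot> (x [^] Suc i \<otimes> y [^] (n - i))"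
  let ?F = "\<lambda>i. [(Suc n choose i)] \<cdot> (x [^] i \<otimes> y [^] (Suc n - i))"
  have B: "?B \<in> A \<rightarrow> carrier R" and C: "?C \<in> A \<rightarrow> carrier R" and D: "?D \<in> A \<rightarrow> carrier R"
    and E: "?E \<in> A \<rightarrow> carrier R" and F: "?F \<in> A \<rightarrow> carrier R" for A
    using assms by auto
  have "(x \<oplus> y) [^] Suc n = finsum R ?B {..n} \<otimes> x \<oplus> finsum R ?B {..n} \<otimes> y"
    using assms B by (simp add: Suc.IH r_distr)
  also have "finsum R ?B {..n} \<otimes> x = finsum R ?C {..n}"
    using assms B
    by (subst finsum_ldistr) (auto simp: add_pow_ldistr add_pow_rdistr m_ac intro!: finsum_cong')
  also have "finsum R ?B {..n} \<otimes> y = finsum R ?D {..n}"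
    using assms B
    by (subst finsum_ldistr) (auto simp: add_pow_ldistr add_pow_rdistr m_ac Suc_diff_le intro!: finsum_cong')
  \<comment> \<open>The added term has coefficient \<open>n choose Suc n = 0\<close>. With it in
    place, splitting off index 0 leaves a sum over \<open>{..n}\<close> that pairs with
    \<open>?C\<close> by Pascal's rule.\<close>
  also have "finsum R ?D {..n} = finsum R ?D {..Suc n}"
    by (subst finsum_Suc[OF D]) (use assms D in \<open>simp add: binomial_eq_0\<close>)
  also have "\<dots> = finsum R ?E {..n} \<oplus> y [^] Suc n"
    by (subst finsum_Suc2[OF D]) (use assms in simp)
  also have "finsum R ?C {..n} \<oplus> (finsum R ?E {..n} \<oplus> y [^] Suc n)
      = finsum R (\<lambda>i. ?C i \<oplus> ?E i) {..n} \<oplus> y [^] Suc n"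
    using assms C E by (subst finsum_addf) (auto simp: a_assoc)
  also have "finsum R (\<lambda>i. ?C i \<oplus> ?E i) {..n} = finsum R (\<lambda>i. ?F (Suc i)) {..n}"
    using assms by (intro finsum_cong') (auto simp: add.nat_pow_mult)
  also have "\<dots> \<oplus> y [^] Suc n = finsum R ?F {..Suc n}"
    by (subst finsum_Suc2[OF F]) (use assms in simp)
  finally show ?case .
qed

text \<open>The prime \<open>p\<close> divides every inner binomial coefficient, so only the two end
  terms of the expansion survive.\<close>

lemma (in cring) frobenius_add:
  assumes p: "prime p" and char: "[p] \<cdot> \<one> = \<zero>" and x: "x \<in> carrier R" and y: "y \<in> carrier R"
  shows "(x \<oplus> y) [^] (p::nat) = x [^] p \<oplus> y [^] p"
proof -
  let ?F = "\<lambda>i. [(p choose i)] \<cdot> (x [^] i \<otimes> y [^] (p - i))"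
  have F: "?F \<in> A \<rightarrow> carrier R" for A
    using x y by auto
  \<comment> \<open>This form lets both end terms be split off: the inner indices 1, ..., p - 1
    become \<open>Suc i\<close> with \<open>i \<le> k\<close>.\<close>
  obtain k where k: "p = Suc (Suc k)"
    using prime_ge_2_nat[OF p] by (auto dest: le_Suc_ex simp: numeral_2_eq_2)
  have zero: "?F i = \<zero>" if i: "0 < i" "i < p" for i
  proof -
    obtain c where c: "p choose i = c * p"
      using dvd_choose_prime[OF i(2) _ _ p] i unfolding dvd_def
      by (metis gr_implies_not0 mult.commute)
    have "[p] \<cdot> z = \<zero>" if "z \<in> carrier R" for z
      using add_pow_ldistr[of \<one> z p] that char by simp
    moreover have "?F i = [p] \<cdot> ([c] \<cdot> (x [^] i \<otimes> y [^] (p - i)))"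
      using x y c by (simp add: add.nat_pow_pow)
    ultimately show ?thesis using x y by simp
  qed
  have "(x \<oplus> y) [^] p = finsum R ?F {..Suc (Suc k)}"
    using binomial[OF x y, of p] by (simp only: k)
  also have "\<dots> = ?F p \<oplus> (finsum R (\<lambda>i. ?F (Suc i)) {..k} \<oplus> ?F 0)"
    by (subst finsum_Suc[OF F], subst finsum_Suc2[OF F]) (simp only: k)
  also have "finsum R (\<lambda>i. ?F (Suc i)) {..k} = \<zero>"
    by (rule add.finprod_one_eqI) (rule zero, auto simp: k)
  finally show ?thesis
    using x y by simp
qed

lemma (in cring) frobenius_power_add:
  assumes p: "prime p" and char: "[p] \<cdot> \<one> = \<zero>" and x: "x \<in> carrier R" and y: "y \<in> carrier R"
  shows "(x \<oplus> y) [^] (p ^ k::nat) = x [^] (p ^ k) \<oplus> y [^] (p ^ k)"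
proof (induction k)
  case (Suc k)
  have "z [^] (p ^ Suc k) = (z [^] (p ^ k)) [^] p" if "z \<in> carrier R" for z
    using that by (simp add: nat_pow_pow mult.commute)
  then show ?case
    using Suc frobenius_add[OF p char] x y by simp
qed (use x y in simp)

text \<open>Additivity applied to \<open>\<ominus> x \<oplus> x\<close> gives this without a case
  split on the parity of \<open>p\<close>. The exponent is nonzero, so the power of zero is zero and
  not one.\<close>

lemma (in cring) frobenius_power_minus:
  assumes p: "prime p" and char: "[p] \<cdot> \<one> = \<zero>" and x: "x \<in> carrier R"
  shows "(\<ominus> x) [^] (p ^ k::nat) = \<ominus> (x [^] (p ^ k))"
proof -
  have "p ^ k \<noteq> 0"
    using prime_gt_0_nat[OF p] by simp
  then have "(\<ominus> x) [^] (p ^ k) \<oplus> x [^] (p ^ k) = \<zero>"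
    using frobenius_power_add[OF p char, of "\<ominus> x" x k] x
    by (simp add: l_neg nat_pow_zero)
  then show ?thesis
    using x by (simp add: minus_equality)
qed

lemma (in ring_hom_ring) hom_add_pow_nat:
  assumes "x \<in> carrier R"
  shows "h ([(n::nat)] \<cdot>\<^bsub>R\<^esub> x) = [n] \<cdot>\<^bsub>S\<^esub> h x"
  using assms by (induction n) auto

section \<open>Counting the roots of X^q - X\<close>

text \<open>Over an algebraically closed field X^q - X has q roots counted with multiplicity, so
  only multiple roots have to be excluded. A divisibility argument does this in place of the
  derivative.\<close>

lemma (in algebraically_closed) card_frobenius_fixpoints:
  assumes p: "prime p" and char: "[p] \<cdot> \<one> = \<zero>" and k: "k > 0"
  shows "card {x \<in> carrier L. x [^] (p ^ k :: nat) = x} = p ^ k"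
proof -
  define q where "q = p ^ k"
  define P where "P = poly_ring L"
  note sub = carrier_is_subring
  interpret UP: domain P
    unfolding P_def by (rule univ_poly_is_domain[OF sub])
  have q: "q \<ge> 2"
    using prime_ge_2_nat[OF p] self_le_power[of p k] k by (simp add: q_def)
  define f where "f = X [^]\<^bsub>P\<^esub> q \<ominus>\<^bsub>P\<^esub> X"
  have X: "X \<in> carrier P" and Xq: "X [^]\<^bsub>P\<^esub> q \<in> carrier P"
    using var_closed(1)[OF sub] var_pow_closed[OF sub] unfolding P_def by auto
  then have f: "f \<in> carrier P"
    by (simp add: f_def)
  have degX: "degree (X [^]\<^bsub>P\<^esub> n) = n" for n :: nat
    unfolding P_def unitary_monom_eq_var_pow[OF sub, symmetric] by (simp add: monom_def)
  have degmX: "degree (\<ominus>\<^bsub>P\<^esub> X) = 1"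
    using univ_poly_a_inv_degree[OF sub] X by (simp add: P_def var_def)
  have deg: "degree f = q"
  proof -
    \<comment> \<open>The degree formula for sums asks for different degrees; here they are q and 1,
      and q is at least 2.\<close>
    have "degree (poly_add (X [^]\<^bsub>P\<^esub> q) (\<ominus>\<^bsub>P\<^esub> X)) = max q 1"
      by (subst poly_add_degree_eq[OF sub])
         (use X Xq q degX degmX UP.a_inv_closed[OF X] in \<open>auto simp: P_def univ_poly_carrier simp del: poly_add.simps\<close>)
    then show ?thesis
      using q by (simp add: f_def a_minus_def P_def univ_poly_add del: poly_add.simps)
  qed
  have f_nz: "f \<noteq> []"
    using deg q by auto
  have eval_f: "eval f a = a [^] q \<ominus> a" if a: "a \<in> carrier L" for a
  proof -
    interpret E: ring_hom_ring P L "\<lambda>g. eval g a"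
      unfolding P_def by (rule eval_ring_hom[OF sub a])
    show ?thesis
      using a X Xq by (simp add: f_def a_minus_def E.hom_nat_pow eval_var)
  qed
  have root_iff: "a \<in># roots f \<longleftrightarrow> a \<in> carrier L \<and> a [^] q = a" for a
    using roots_mem_iff_is_root[of f a] f f_nz
    by (cases "a \<in> carrier L") (simp_all add: is_root_def P_def eval_f)
  have simple: "count (roots f) a = 1" if a: "a \<in># roots f" for a
  proof (rule ccontr)
    have aL: "a \<in> carrier L" and aq: "a [^] q = a"
      using a root_iff by auto
    assume "count (roots f) a \<noteq> 1"
    moreover have "0 < count (roots f) a"
      using a by simp
    ultimately have "2 \<le> count (roots f) a"
      by linarith
    then have "2 \<le> alg_mult f a"
      using alg_mult_eq_count_roots[of f] f by (simp add: P_def)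
    then have "[\<one>, \<ominus> a] [^]\<^bsub>P\<^esub> (2::nat) pdivides f"
      using le_alg_mult_imp_pdivides[OF aL, of f 2] f by (simp add: P_def)
    then obtain s where s: "s \<in> carrier P" and fs: "f = [\<one>, \<ominus> a] [^]\<^bsub>P\<^esub> (2::nat) \<otimes>\<^bsub>P\<^esub> s"
      by (auto simp: pdivides_def P_def)
    \<comment> \<open>Coefficient lists start with the leading coefficient, so \<open>D\<close> is X
      - a.\<close>
    define D where "D = [\<one>, \<ominus> a]"
    interpret C: ring_hom_ring "L" P poly_of_const
      using canonical_embedding_ring_hom[OF sub] by (simp add: P_def)
    interpret E: ring_hom_ring P L "\<lambda>g. eval g a"
      unfolding P_def by (rule eval_ring_hom[OF sub aL])
    have D: "D \<in> carrier P" "eval D a = \<zero>"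
      using aL by (auto simp: D_def P_def univ_poly_def polynomial_def r_neg)
    have DX: "D = X \<ominus>\<^bsub>P\<^esub> poly_of_const a"
    proof -
      have "D = X \<oplus>\<^bsub>P\<^esub> poly_of_const (\<ominus> a)"
        using aL by (auto simp: poly_of_const_def D_def P_def univ_poly_add var_def)
      then show ?thesis
        using C.hom_a_inv[OF aL] by (simp add: a_minus_def)
    qed
    \<comment> \<open>The constants embed \<open>L\<close> into \<open>P\<close>, so the Frobenius
      lemmas apply to polynomials as well.\<close>
    have charP: "[p] \<cdot>\<^bsub>P\<^esub> \<one>\<^bsub>P\<^esub> = \<zero>\<^bsub>P\<^esub>"
      using C.hom_add_pow_nat[of \<one> p] char by simp
    have "D [^]\<^bsub>P\<^esub> q = X [^]\<^bsub>P\<^esub> q \<ominus>\<^bsub>P\<^esub> poly_of_const a"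
      using UP.frobenius_power_add[OF p charP, of X "\<ominus>\<^bsub>P\<^esub> poly_of_const a" k]
        UP.frobenius_power_minus[OF p charP, of "poly_of_const a" k] X aL aq
      by (simp add: DX a_minus_def q_def C.hom_nat_pow[symmetric])
    \<comment> \<open>Since a^q = a, the q-th power of \<open>D\<close> is X^q - a; subtracting X -
      a cancels the constant.\<close>
    then have "f = D [^]\<^bsub>P\<^esub> q \<ominus>\<^bsub>P\<^esub> D"
      using X Xq C.hom_closed[OF aL] unfolding f_def DX
      by algebra
    also have "D [^]\<^bsub>P\<^esub> q = D \<otimes>\<^bsub>P\<^esub> D [^]\<^bsub>P\<^esub> (q - 1)"
      using q D UP.nat_pow_Suc2[of D "q - 1"] by simp
    \<comment> \<open>Cancelling one factor \<open>D\<close> and evaluating at its root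
      \<open>a\<close> leaves -1 on the left, because q - 1 > 0, and 0 on the right.\<close>
    finally have "D \<otimes>\<^bsub>P\<^esub> (D [^]\<^bsub>P\<^esub> (q - 1) \<ominus>\<^bsub>P\<^esub> \<one>\<^bsub>P\<^esub>) = D \<otimes>\<^bsub>P\<^esub> (D \<otimes>\<^bsub>P\<^esub> s)"
      using D s by (simp add: fs D_def[symmetric] numeral_2_eq_2 a_minus_def UP.r_distr UP.r_minus UP.m_assoc)
    moreover have "D \<noteq> \<zero>\<^bsub>P\<^esub>"
      by (simp add: D_def P_def univ_poly_zero)
    ultimately have "D [^]\<^bsub>P\<^esub> (q - 1) \<ominus>\<^bsub>P\<^esub> \<one>\<^bsub>P\<^esub> = D \<otimes>\<^bsub>P\<^esub> s"
      using D s by (subst (asm) UP.m_lcancel) auto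
    then have "eval (D [^]\<^bsub>P\<^esub> (q - 1) \<ominus>\<^bsub>P\<^esub> \<one>\<^bsub>P\<^esub>) a = \<zero>"
      using D s by simp
    then have "\<zero> [^] (q - 1) \<ominus> \<one> = \<zero>"
      using D q by (simp add: a_minus_def E.hom_nat_pow)
    then show False
      using q by (simp add: nat_pow_zero)
  qed
  \<comment> \<open>\<open>f\<close> splits, so its degree is the size of its multiset of roots;
    simplicity turns that size into a cardinality.\<close>
  have "q = size (roots f)"
    using roots_over_carrier[of f] f deg by (simp add: splitted_def P_def)
  also have "\<dots> = card (set_mset (roots f))"
    by (simp add: size_multiset_overloaded_eq simple)
  also have "set_mset (roots f) = {x \<in> carrier L. x [^] q = x}"
    using root_iff by auto
  finally show ?thesis by (simp add: q_def)
qed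

section \<open>The field of order q\<close>

lemma (in field) frobenius_fixpoints_subfield:
  assumes p: "prime p" and char: "[p] \<cdot> \<one> = \<zero>"
  shows "subfield {x \<in> carrier R. x [^] (p ^ k :: nat) = x} R" (is "subfield ?S R")
proof (rule subfieldI')
  show "subring ?S R"
    by (rule subringI)
       (auto simp: nat_pow_distrib frobenius_power_add[OF p char] frobenius_power_minus[OF p char])
  fix x assume x: "x \<in> ?S - {\<zero>}"
  then have u: "x \<in> Units R"
    by (simp add: field_Units)
  show "inv x \<in> ?S"
  proof (intro CollectI conjI)
    show "inv x \<in> carrier R" using u by simp
    have "inv x [^] (p ^ k) \<otimes> x [^] (p ^ k) = (inv x \<otimes> x) [^] (p ^ k)"
      using u by (intro nat_pow_distrib[symmetric]) auto
    \<comment> \<open>The q-th power of \<open>inv x\<close> is an inverse of x^q = x, and inverses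
      are unique.\<close>
    then have "inv x [^] (p ^ k) \<otimes> x = \<one>"
      using x u by simp
    then show "inv x [^] (p ^ k) = inv x"
      using u by (metis Units_closed Units_inv_closed Units_r_inv inv_unique nat_pow_closed)
  qed
qed

text \<open>The statement has to fix an element type. This one is that of \<open>alg_closure\<close>
  over integer residues: polynomials in variables indexed by pairs of a polynomial and a
  number.\<close>

lemma ex_finite_field:
  assumes "primepow q"
  obtains F :: "(((int list \<times> nat) multiset) \<Rightarrow> int) ring"
  where "field F" and "card (carrier F) = q"
proof -
  obtain p k where p: "prime p" and k: "k > 0" and q: "q = p ^ k"
    using assms by (auto simp: primepow_def)
  interpret Fp: residues_prime p "residue_ring (int p)"
    using p by (simp_all add: residues_prime_def)
  define L where "L = Fp.alg_closure"
  interpret algebraic_closure L "Fp.indexed_const ` carrier (residue_ring (int p))"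
    unfolding L_def by (rule Fp.alg_closureE)
  interpret H: ring_hom_ring "residue_ring (int p)" L Fp.indexed_const
    unfolding L_def
    by (rule ring_hom_ringI2) (use Fp.alg_closureE in \<open>simp_all add: Fp.ring_axioms L_def[symmetric] ring_axioms\<close>)
  have "[n] \<cdot>\<^bsub>residue_ring (int p)\<^esub> \<one>\<^bsub>residue_ring (int p)\<^esub> = int n mod int p" for n :: nat
  proof (induction n)
    case (Suc n)
    then show ?case
      by (simp add: Fp.res_add_eq Fp.res_one_eq mod_simps add.commute)
  qed (simp add: Fp.res_zero_eq)
  then have char: "[p] \<cdot>\<^bsub>L\<^esub> \<one>\<^bsub>L\<^esub> = \<zero>\<^bsub>L\<^esub>"
    using H.hom_add_pow_nat[of "\<one>\<^bsub>residue_ring (int p)\<^esub>" p] by (simp add: Fp.res_zero_eq[symmetric])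
  let ?S = "{x \<in> carrier L. x [^]\<^bsub>L\<^esub> (p ^ k :: nat) = x}"
  show thesis
  proof (rule that)
    show "field (L\<lparr>carrier := ?S\<rparr>)"
      using frobenius_fixpoints_subfield[OF p char] by (rule subfield_iff(2))
    show "card (carrier (L\<lparr>carrier := ?S\<rparr>)) = q"
      using card_frobenius_fixpoints[OF p char k] by (simp add: q)
  qed
qed

section \<open>Affine planes glued along the line at infinity\<close>

text \<open>
  \<open>t s x b\<close> is the ordinate at \<open>x\<close> of the line with slope \<open>s\<close> and intercept \<open>b\<close>, that is
  \<open>s \<cdot> x + b\<close> over a field whose elements are numbered from \<open>0\<close> to \<open>q - 1\<close>.
\<close>

locale affine_plane_coordinates =
  fixes q :: nat and t :: "nat \<Rightarrow> nat \<Rightarrow> nat \<Rightarrow> nat"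
  assumes order: "q \<ge> 2"
    and range: "t s x b < q"
    and parallel: "inj_on (t s x) {..<q}"
    and meet: "s < q \<Longrightarrow> s' < q \<Longrightarrow> b < q \<Longrightarrow> b' < q \<Longrightarrow> s \<noteq> s' \<Longrightarrow>
           \<exists>!x. x < q \<and> t s x b = t s' x b'"

section \<open>Numerical coordinates from a finite field\<close>

lemma (in field) ex_affine_plane_coordinates:
  assumes card: "card (carrier R) = q" and q2: "q \<ge> 2"
  obtains t where "affine_plane_coordinates q t"
proof -
  have q: "q > 0"
    using q2 by simp
  have "finite (carrier R)"
    using card q card_ge_0_finite by auto
  then obtain h where h: "bij_betw h {..<q} (carrier R)"
    using ex_bij_betw_nat_finite card by (auto simp: atLeast0LessThan)
  define g where "g = inv_into {..<q} h"
  have hF: "x < q \<Longrightarrow> h x \<in> carrier R" and hinj: "x < q \<Longrightarrow> y < q \<Longrightarrow> h x = h y \<longleftrightarrow> x = y"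
    and gq: "a \<in> carrier R \<Longrightarrow> g a < q" and hg: "a \<in> carrier R \<Longrightarrow> h (g a) = a" for x y a
    using h bij_betw_inv_into[OF h] bij_betw_inv_into_right[OF h]
    by (auto simp: g_def bij_betw_def inj_on_eq_iff)
  have ginj: "a \<in> carrier R \<Longrightarrow> b \<in> carrier R \<Longrightarrow> g a = g b \<longleftrightarrow> a = b" for a b
    by (metis hg)
  \<comment> \<open>Reducing modulo \<open>q\<close> keeps every argument of \<open>h\<close> in its
    domain, so that \<open>range\<close> and \<open>parallel\<close> hold for all numbers.\<close>
  define t where "t s x b = g (h (s mod q) \<otimes> h (x mod q) \<oplus> h (b mod q))" for s x b
  show thesis
  proof (rule that, unfold_locales)
    show "q \<ge> 2"
      by (fact q2)
    show "t s x b < q" for s x b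
      using q by (simp add: t_def gq hF)
    show "inj_on (t s x) {..<q}" for s x
    proof (rule inj_onI)
      fix b b' assume b: "b \<in> {..<q}" "b' \<in> {..<q}" and eq: "t s x b = t s x b'"
      have "h (s mod q) \<otimes> h (x mod q) \<in> carrier R"
        using q hF by simp
      then show "b = b'"
        using eq b hF by (simp add: t_def ginj hinj)
    qed
    fix s s' b b'
    assume lt: "s < q" "s' < q" "b < q" "b' < q" and ne: "s \<noteq> s'"
    have F: "h s \<in> carrier R" "h s' \<in> carrier R" "h b \<in> carrier R" "h b' \<in> carrier R"
      using lt hF by auto
    \<comment> \<open>Lines of slopes s and s' meet where (s - s') x = b' - b; the difference of the
      slopes is nonzero, hence invertible.\<close>
    define d where "d = h s \<ominus> h s'"
    have d: "d \<in> Units R"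
      using F ne lt hinj by (simp add: d_def field_Units)
    then have dF: "d \<in> carrier R" "inv d \<in> carrier R"
      by auto
    have iff: "t s x b = t s' x b' \<longleftrightarrow> h x = inv d \<otimes> (h b' \<ominus> h b)" if x: "x < q" for x
    proof -
      have "t s x b = t s' x b' \<longleftrightarrow> h s \<otimes> h x \<oplus> h b = h s' \<otimes> h x \<oplus> h b'"
        using x lt F hF by (simp add: t_def ginj)
      also have "\<dots> \<longleftrightarrow> d \<otimes> h x = h b' \<ominus> h b" (is "?l = ?r \<longleftrightarrow> ?l' = ?r'")
      proof -
        have "?l \<ominus> ?r = ?l' \<ominus> ?r'"
          using F hF[OF x] unfolding d_def by algebra
        moreover have "?l \<in> carrier R" "?r \<in> carrier R" "?l' \<in> carrier R" "?r' \<in> carrier R"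
          using F dF hF[OF x] by auto
        ultimately show ?thesis
          using r_right_minus_eq by metis
      qed
      also have "\<dots> \<longleftrightarrow> h x = inv d \<otimes> (h b' \<ominus> h b)"
      proof
        assume "d \<otimes> h x = h b' \<ominus> h b"
        then have "inv d \<otimes> (h b' \<ominus> h b) = (inv d \<otimes> d) \<otimes> h x"
          using dF hF[OF x] m_assoc by metis
        then show "h x = inv d \<otimes> (h b' \<ominus> h b)"
          using d hF[OF x] by simp
      qed (use d dF F in \<open>simp add: m_assoc[symmetric]\<close>)
      finally show ?thesis .
    qed
    show "\<exists>!x. x < q \<and> t s x b = t s' x b'"
    proof (rule ex1I[of _ "g (inv d \<otimes> (h b' \<ominus> h b))"])
      show "g (inv d \<otimes> (h b' \<ominus> h b)) < q \<and>
          t s (g (inv d \<otimes> (h b' \<ominus> h b))) b = t s' (g (inv d \<otimes> (h b' \<ominus> h b))) b'"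
        using F dF by (simp add: gq iff hg)
      show "x = g (inv d \<otimes> (h b' \<ominus> h b))" if "x < q \<and> t s x b = t s' x b'" for x
        using that iff[of x] F dF hinj[of x "g (inv d \<otimes> (h b' \<ominus> h b))"] by (simp add: gq hg)
    qed
  qed
qed

section \<open>The pattern common to both forbidden configurations\<close>

definition hg_image :: "('a \<Rightarrow> 'b) \<Rightarrow> 'a hypergraph \<Rightarrow> 'b hypergraph" where
  "hg_image f H = (f ` verts H, (`) f ` edges H)"

text \<open>Excluding this one pattern handles both forbidden graphs. The conditions make the four
  edges distinct: \<open>a\<close>, \<open>b\<close>, \<open>c\<close> are nonempty and disjoint,
  and \<open>e\<close> meets all of them.\<close>

definition meets_three_disjoint :: "'a hypergraph \<Rightarrow> bool" where
  "meets_three_disjoint H \<longleftrightarrow> (\<exists>e\<in>edges H. \<exists>a\<in>edges H. \<exists>b\<in>edges H. \<exists>c\<in>edges H.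
     a \<inter> b = {} \<and> a \<inter> c = {} \<and> b \<inter> c = {} \<and> e \<inter> a \<noteq> {} \<and> e \<inter> b \<noteq> {} \<and> e \<inter> c \<noteq> {})"

lemma meets_three_disjoint_hg_image:
  assumes "inj f" and "meets_three_disjoint (hg_image f H)"
  shows "meets_three_disjoint H"
  using assms unfolding meets_three_disjoint_def hg_image_def
  by (simp add: image_Int[symmetric])

text \<open>An embedding is injective on the vertices, so it commutes with intersections of edges
  and preserves both disjointness and meeting.\<close>

lemma meets_three_disjoint_contains_copy:
  assumes copy: "contains_copy H F" and wf: "\<And>e. e \<in> edges F \<Longrightarrow> e \<subseteq> verts F"
    and F: "meets_three_disjoint F"
  shows "meets_three_disjoint H"
proof -
  obtain \<phi> where inj: "inj_on \<phi> (verts F)" and edges: "\<And>e. e \<in> edges F \<Longrightarrow> \<phi> ` e \<in> edges H"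
    using copy by (auto simp: contains_copy_def)
  have Int: "\<phi> ` e \<inter> \<phi> ` f = \<phi> ` (e \<inter> f)" if "e \<in> edges F" "f \<in> edges F" for e f
    using inj_on_image_Int[OF inj] wf that by auto
  obtain e a b c where mem: "e \<in> edges F" "a \<in> edges F" "b \<in> edges F" "c \<in> edges F"
    and "a \<inter> b = {}" "a \<inter> c = {}" "b \<inter> c = {}" "e \<inter> a \<noteq> {}" "e \<inter> b \<noteq> {}" "e \<inter> c \<noteq> {}"
    using F unfolding meets_three_disjoint_def by (elim bexE conjE) (rule that)
  then have "\<phi> ` a \<inter> \<phi> ` b = {}" "\<phi> ` a \<inter> \<phi> ` c = {}" "\<phi> ` b \<inter> \<phi> ` c = {}"
    "\<phi> ` e \<inter> \<phi> ` a \<noteq> {}" "\<phi> ` e \<inter> \<phi> ` b \<noteq> {}" "\<phi> ` e \<inter> \<phi> ` c \<noteq> {}"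
    by (simp_all add: Int)
  then show ?thesis
    unfolding meets_three_disjoint_def using mem[THEN edges]
    by (intro bexI[of _ "\<phi> ` e"] bexI[of _ "\<phi> ` a"] bexI[of _ "\<phi> ` b"] bexI[of _ "\<phi> ` c"] conjI)
qed

lemma crown_meets_three_disjoint:
  assumes "r \<ge> 3"
  shows "meets_three_disjoint (crown r)"
proof -
  have "crown_row r i \<in> edges (crown r)" "column0 r \<inter> crown_row r i \<noteq> {}" if "i < r" for i
    using that crown_row_Int_column0[OF that] by (auto simp: crown_def)
  moreover have "column0 r \<in> edges (crown r)"
    by (simp add: crown_def)
  ultimately show ?thesis
    unfolding meets_three_disjoint_def using assms
    by (intro bexI[of _ "column0 r"] bexI[of _ "crown_row r 0"] bexI[of _ "crown_row r 1"]
        bexI[of _ "crown_row r 2"] conjI) (auto simp: crown_row_disjoint)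
qed

text \<open>The rows through the centre pairwise meet, so only one of them, row 0, can be used; the
  two free rows \<open>r - 2\<close> and \<open>r - 1\<close> complete the triple.\<close>

lemma cstar_meets_three_disjoint:
  assumes "r \<ge> 3"
  shows "meets_three_disjoint (cstar r)"
proof -
  have "cstar_row r i \<in> edges (cstar r)" "column0 r \<inter> cstar_row r i \<noteq> {}" if "i < r" for i
    using that cstar_row_Int_column0[OF assms that] by (auto simp: cstar_def)
  moreover have "column0 r \<in> edges (cstar r)"
    by (simp add: cstar_def)
  moreover have "cstar_row r 0 \<inter> cstar_row r (r - 2) = {}" "cstar_row r 0 \<inter> cstar_row r (r - 1) = {}"
    "cstar_row r (r - 2) \<inter> cstar_row r (r - 1) = {}"
    using assms by (simp_all add: cstar_row_disjoint)
  ultimately show ?thesis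
    unfolding meets_three_disjoint_def using assms
    by (intro bexI[of _ "column0 r"] bexI[of _ "cstar_row r 0"] bexI[of _ "cstar_row r (r - 2)"]
        bexI[of _ "cstar_row r (r - 1)"] conjI) auto
qed

lemma free_of_crown_cstar:
  assumes "r \<ge> 3" and "\<not> meets_three_disjoint H"
  shows "free_of {crown r, cstar r} H"
  using assms crown_meets_three_disjoint[of r] cstar_meets_three_disjoint[of r]
    crown_r_graph[of r] cstar_r_graph[of r]
    meets_three_disjoint_contains_copy[of H "crown r"] meets_three_disjoint_contains_copy[of H "cstar r"]
  by (auto simp: free_of_def r_graph_def)

lemma hg_image_r_graph: "inj f \<Longrightarrow> r_graph r H \<Longrightarrow> r_graph r (hg_image f H)"
  by (auto simp: r_graph_def hg_image_def card_image inj_on_subset)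

lemma hg_image_linear:
  assumes f: "inj f" and H: "linear_hg H"
  shows "linear_hg (hg_image f H)"
  using H by (simp add: linear_hg_def hg_image_def image_Int[OF f, symmetric]
      card_image[OF inj_on_subset[OF f subset_UNIV]] inj_image_eq_iff[OF f])

lemma card_hg_image:
  assumes "inj f"
  shows "card (verts (hg_image f H)) = card (verts H)" "card (edges (hg_image f H)) = card (edges H)"
proof -
  show "card (verts (hg_image f H)) = card (verts H)"
    using assms by (simp add: hg_image_def card_image inj_on_subset)
  have "inj ((`) f)"
    using assms by (simp add: inj_image_eq_iff inj_def)
  then show "card (edges (hg_image f H)) = card (edges H)"
    by (simp add: hg_image_def card_image inj_on_subset)
qed

section \<open>The glued planes and their intersection pattern\<close>

context affine_plane_coordinates
begin

text \<open>
  \<open>Inl (k, x, y)\<close> is the affine point \<open>(x, y)\<close> of the \<open>k\<close>-th copy of the plane and \<open>Inr s\<close>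
  the point at infinity of the lines of slope \<open>s\<close>, which all copies share; the slope \<open>q\<close> is
  that of the vertical lines.
\<close>

type_synonym point = "(nat \<times> nat \<times> nat) + nat"

definition line :: "nat \<Rightarrow> nat \<Rightarrow> nat \<Rightarrow> point set" where
  "line k s b = insert (Inr s) ((\<lambda>x. Inl (k, if s < q then (x, t s x b) else (b, x))) ` {..<q})"

definition glued :: "nat \<Rightarrow> point hypergraph" where
  "glued m = (({..<m} \<times> {..<q} \<times> {..<q}) <+> {..q},
     (\<lambda>(k, s, b). line k s b) ` ({..<m} \<times> {..q} \<times> {..<q}))"

lemma Inr_in_line: "Inr s' \<in> line k s b \<longleftrightarrow> s' = s"
  by (auto simp: line_def)

lemma Inl_in_line: "Inl (k', x, y) \<in> line k s b \<longleftrightarrow>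
    k' = k \<and> x < q \<and> y < q \<and> (if s < q then y = t s x b else x = b)" if "b < q"
  using that range by (auto simp: line_def)

lemma card_line: "card (line k s b) = q + 1"
proof -
  have "inj_on (\<lambda>x. Inl (k, if s < q then (x, t s x b) else (b, x)) :: point) {..<q}"
    by (auto simp: inj_on_def)
  then have "card ((\<lambda>x. Inl (k, if s < q then (x, t s x b) else (b, x)) :: point) ` {..<q}) = q"
    by (simp add: card_image)
  then show ?thesis
    unfolding line_def by (subst card_insert_disjoint) auto
qed

lemma line_Int_same_copy:
  assumes lt: "b < q" "b' < q" and s: "s \<le> q" "s' \<le> q" and ne: "s \<noteq> s'"
  shows "\<exists>z. line k s b \<inter> line k s' b' = {z}"
proof -
  \<comment> \<open>By symmetry the first slope is the smaller one, so only the second line can be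
    vertical.\<close>
  have step: "\<exists>z. line k s b \<inter> line k s' b' = {z}"
    if "b < q" "b' < q" "s < s'" "s' \<le> q" for s s' b b'
  proof -
    \<comment> \<open>The common affine point comes from \<open>meet\<close> for two proper slopes;
      if the second line is vertical, it is the point of the first line with abscissa
      \<open>b'\<close>.\<close>
    have "\<exists>x y. x < q \<and> y < q \<and> (\<forall>x' y'. x' < q \<longrightarrow>
      (y' = t s x' b \<and> (if s' < q then y' = t s' x' b' else x' = b') \<longleftrightarrow> x' = x \<and> y' = y))"
    proof (cases "s' < q")
      case True
      have "\<exists>!x. x < q \<and> t s x b = t s' x b'"
        using that True by (intro meet) auto
      then obtain x where x: "x < q \<and> t s x b = t s' x b'"
        and uniq: "\<forall>x'. x' < q \<and> t s x' b = t s' x' b' \<longrightarrow> x' = x"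
        by (rule ex1E)
      show ?thesis
      proof (intro exI conjI allI impI)
        show "x < q" "t s x b < q"
          using x range by simp_all
        show "y' = t s x' b \<and> (if s' < q then y' = t s' x' b' else x' = b') \<longleftrightarrow> x' = x \<and> y' = t s x b"
          if "x' < q" for x' y'
          using that x uniq True by metis
      qed
    next
      case False
      then show ?thesis
        using range \<open>b' < q\<close> by (intro exI[of _ b'] exI[of _ "t s b' b"]) auto
    qed
    then obtain x y where "x < q" "y < q" and xy: "\<And>x' y'. x' < q \<Longrightarrow>
      y' = t s x' b \<and> (if s' < q then y' = t s' x' b' else x' = b') \<longleftrightarrow> x' = x \<and> y' = y"
      by metis
    then have "z \<in> line k s b \<inter> line k s' b' \<longleftrightarrow> z = Inl (k, x, y)" for z
    proof (cases z)
      case (Inl u)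
      obtain k' x' y' where "u = (k', x', y')"
        by (cases u)
      with Inl xy[of x' y'] \<open>x < q\<close> \<open>y < q\<close> show ?thesis
        using that range by (auto simp: Inl_in_line split: if_splits)
    qed (use that in \<open>auto simp: Inr_in_line\<close>)
    then show ?thesis by blast
  qed
  show ?thesis
  proof (cases "s < s'")
    case True
    then show ?thesis using step lt s by simp
  next
    case False
    then show ?thesis using step[of b' b s' s] lt s ne by (simp add: Int_commute)
  qed
qed

lemma line_Int_subset_singleton:
  assumes lt: "b < q" "b' < q" and s: "s \<le> q" "s' \<le> q" and ne: "(k, s, b) \<noteq> (k', s', b')"
  shows "\<exists>z. line k s b \<inter> line k' s' b' \<subseteq> {z}"
proof (cases "k = k' \<and> s \<noteq> s'")
  case True
  then show ?thesis using line_Int_same_copy[OF lt s] by blast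
next
  case False
  \<comment> \<open>A common affine point would force the same copy, hence here the same slope, and
    then the same intercept by \<open>parallel\<close>, or by the abscissa for vertical
    lines.\<close>
  have "z = Inr s" if "z \<in> line k s b" "z \<in> line k' s' b'" for z
    using that False ne lt parallel[of s] by (cases z) (auto simp: Inl_in_line Inr_in_line inj_on_def split: if_splits)
  then show ?thesis by blast
qed

lemma card_line_Int:
  assumes "b < q" "b' < q" "s \<le> q" "s' \<le> q" "(k, s, b) \<noteq> (k', s', b')"
  shows "card (line k s b \<inter> line k' s' b') \<le> 1"
proof -
  obtain z where "line k s b \<inter> line k' s' b' \<subseteq> {z}"
    using line_Int_subset_singleton[OF assms] by blast
  then show ?thesis
    using card_mono[of "{z}"] by simp
qed

text \<open>A line has q + 1 > 1 points, while lines with different parameters share at most one.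
  This is what makes the edge count exact.\<close>

lemma inj_on_line: "inj_on (\<lambda>(k, s, b). line k s b) (A \<times> {..q} \<times> {..<q})"
proof (rule inj_onI)
  fix u v
  assume uv: "u \<in> A \<times> {..q} \<times> {..<q}" "v \<in> A \<times> {..q} \<times> {..<q}"
    and line: "(case u of (k, s, b) \<Rightarrow> line k s b) = (case v of (k, s, b) \<Rightarrow> line k s b)"
  obtain k s b k' s' b' where u: "u = (k, s, b)" and v: "v = (k', s', b')"
    by (metis prod_cases3)
  have lt: "s \<le> q" "b < q" "s' \<le> q" "b' < q" and eq: "line k s b = line k' s' b'"
    using uv line by (auto simp: u v)
  have "(k, s, b) = (k', s', b')"
  proof (rule ccontr)
    assume "(k, s, b) \<noteq> (k', s', b')"
    then have "card (line k s b) \<le> 1"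
      using card_line_Int[of b b' s s' k k'] lt eq by simp
    then show False
      using order by (simp add: card_line)
  qed
  then show "u = v" by (simp add: u v)
qed

lemma glued_r_graph: "r_graph (q + 1) (glued m)"
  using range by (auto simp: r_graph_def glued_def card_line) (auto simp: line_def)

lemma glued_linear: "linear_hg (glued m)"
proof -
  have "card (line k s b \<inter> line k' s' b') \<le> 1"
    if "s \<le> q" "b < q" "s' \<le> q" "b' < q" "line k s b \<noteq> line k' s' b'" for k s b k' s' b'
    using that card_line_Int[of b b' s s' k k'] by auto
  then show ?thesis
    by (auto simp: linear_hg_def glued_def)
qed

lemma card_verts_glued: "card (verts (glued m)) = q\<^sup>2 * m + (q + 1)"
  by (simp add: glued_def card_Plus card_cartesian_product power2_eq_square)

lemma card_edges_glued: "card (edges (glued m)) = (q + 1) * q * m"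
  by (simp add: glued_def card_image[OF inj_on_line] card_cartesian_product)

text \<open>Pigeonhole: an edge meeting another one shares its copy or its slope. Of three edges,
  two would share the same one of these with \<open>e0\<close>, but disjoint edges differ in
  both.\<close>

lemma glued_not_meets_three_disjoint: "\<not> meets_three_disjoint (glued m)"
proof
  assume "meets_three_disjoint (glued m)"
  then obtain e0 e1 e2 e3
    where e: "e0 \<in> edges (glued m)" "e1 \<in> edges (glued m)" "e2 \<in> edges (glued m)" "e3 \<in> edges (glued m)"
      and e_disj: "e1 \<inter> e2 = {}" "e1 \<inter> e3 = {}" "e2 \<inter> e3 = {}"
      and e_meet: "e0 \<inter> e1 \<noteq> {}" "e0 \<inter> e2 \<noteq> {}" "e0 \<inter> e3 \<noteq> {}"
    unfolding meets_three_disjoint_def by (elim bexE conjE) (rule that)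
  have edgeE: "\<exists>k s b. s \<le> q \<and> b < q \<and> e = line k s b" if "e \<in> edges (glued m)" for e
    using that by (auto simp: glued_def)
  obtain k s b where e0: "e0 = line k s b" and lt0: "s \<le> q" "b < q"
    using edgeE[OF e(1)] by blast
  obtain k1 s1 b1 where e1: "e1 = line k1 s1 b1" and lt1: "s1 \<le> q" "b1 < q"
    using edgeE[OF e(2)] by blast
  obtain k2 s2 b2 where e2: "e2 = line k2 s2 b2" and lt2: "s2 \<le> q" "b2 < q"
    using edgeE[OF e(3)] by blast
  obtain k3 s3 b3 where e3: "e3 = line k3 s3 b3" and lt3: "s3 \<le> q" "b3 < q"
    using edgeE[OF e(4)] by blast
  note lt = lt0 lt1 lt2 lt3 and eqs = e0 e1 e2 e3
  note disj = e_disj[unfolded eqs] and meet = e_meet[unfolded eqs]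
  \<comment> \<open>Equal slopes give a common point at infinity, and different slopes in one copy
    give a common affine point.\<close>
  have ne: "k' \<noteq> k'' \<and> s' \<noteq> s''"
    if "line k' s' b' \<inter> line k'' s'' b'' = {}" "s' \<le> q" "s'' \<le> q" "b' < q" "b'' < q"
    for k' s' b' k'' s'' b''
  proof -
    have "s' \<noteq> s''"
      using that(1) Inr_in_line by blast
    then show ?thesis
      using that line_Int_same_copy[of b' b'' s' s'' k'] by auto
  qed
  have same: "k' = k \<or> s' = s" if "line k s b \<inter> line k' s' b' \<noteq> {}" "b' < q" for k' s' b'
  proof -
    obtain z where "z \<in> line k s b" "z \<in> line k' s' b'"
      using \<open>line k s b \<inter> line k' s' b' \<noteq> {}\<close> by blast
    then show ?thesis
      using lt \<open>b' < q\<close> by (cases z) (auto simp: Inl_in_line Inr_in_line)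
  qed
  have "k1 \<noteq> k2" "s1 \<noteq> s2" "k1 \<noteq> k3" "s1 \<noteq> s3" "k2 \<noteq> k3" "s2 \<noteq> s3"
    using ne[OF disj(1)] ne[OF disj(2)] ne[OF disj(3)] lt by auto
  moreover have "k1 = k \<or> s1 = s" "k2 = k \<or> s2 = s" "k3 = k \<or> s3 = s"
    using same[OF meet(1)] same[OF meet(2)] same[OF meet(3)] lt by auto
  ultimately show False by auto
qed

end

section \<open>Assembly for q = r - 1 and the bound on \<open>ex_lin\<close>\<close>

theorem mainTheorem2:
  fixes r m n :: nat
  assumes "r \<ge> 3"
    and "primepow (r - 1)"
    and "m \<ge> 1"
    and "n = (r - 1)\<^sup>2 * m + r"
  shows "(\<exists>H :: nat hypergraph. r_graph r H \<and> linear_hg H \<and> card (verts H) = n \<and>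
            free_of {crown r, cstar r} H \<and> card (edges H) = r * (r - 1) * m) \<and>
         int (ex_lin r n {crown r, cstar r}) \<ge>
           int r * (int r - 1) * \<lfloor>(real n - real r) / (real r - 1)\<^sup>2\<rfloor>"
proof -
  define q where "q = r - 1"
  have r: "r = q + 1" and q: "q \<ge> 2"
    using assms(1) by (auto simp: q_def)
  obtain F :: "(((int list \<times> nat) multiset) \<Rightarrow> int) ring"
    where F: "field F" and card: "card (carrier F) = q"
    using ex_finite_field[of q] assms(2) by (auto simp: q_def)
  obtain t where "affine_plane_coordinates q t"
    using field.ex_affine_plane_coordinates[OF F card q] .
  then interpret affine_plane_coordinates q t .
  \<comment> \<open>\<open>ex_lin\<close> ranges over hypergraphs on natural numbers; the points
    form a countable type, so \<open>to_nat\<close> relabels them injectively.\<close>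
  define H where "H = hg_image to_nat (glued m)"
  have free: "free_of {crown r, cstar r} H"
    using free_of_crown_cstar[OF assms(1)] meets_three_disjoint_hg_image[OF inj_to_nat]
      glued_not_meets_three_disjoint unfolding H_def by blast
  have H: "r_graph r H" "linear_hg H" "card (verts H) = n" "card (edges H) = r * (r - 1) * m"
    using hg_image_r_graph[OF inj_to_nat glued_r_graph] hg_image_linear[OF inj_to_nat glued_linear]
    unfolding H_def card_hg_image[OF inj_to_nat] card_verts_glued card_edges_glued assms(4)
    by (simp_all add: r)
  have "card (edges H) \<le> ex_lin r n {crown r, cstar r}"
    unfolding ex_lin_def using H free by (intro Max_ge[OF finite_ex_lin_set]) blast
  then have "int (r * (r - 1) * m) \<le> int (ex_lin r n {crown r, cstar r})"
    unfolding H(4) by (rule of_nat_mono)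
  then have "int (ex_lin r n {crown r, cstar r}) \<ge> int r * (int r - 1) * int m"
    by (simp add: r algebra_simps)
  \<comment> \<open>The quotient under the floor is exactly \<open>m\<close>, so rounding loses
    nothing.\<close>
  moreover have "(real n - real r) / (real r - 1)\<^sup>2 = real m"
    using q by (simp add: assms(4) r)
  ultimately show ?thesis
    using H free by (intro conjI exI[of _ H]) simp_all
qed

end
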